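(* Let $S$ be a topological semigroup acting on a completely regular space $X$ endowed with an admissible family of open coverings $\mathcal{O}$, and let $\mathcal{F}$ be a filter basis on the subsets of $S$. Assume that $X$ is a complete admissible space. If the semigroup action $(S,X)$ is $\mathcal{F}$-limit compact then, for every bounded set $Y\subset X$, the $\omega$-limit set $\omega(Y,\mathcal{F})$ is nonempty and compact, and the net $(\mathrm{cls}(AY))_{A\in\mathcal{F}}$ converges to $\omega(Y,\mathcal{F})$ in $\mathcal{H}(X)$.
   Context: For coverings $\mathcal{U},\mathcal{V}$ of $X$, $\mathcal{V}\leqslant\frac12\mathcal{U}$ means: for all $V,V'\in\mathcal{V}$ with $V\cap V'\neq\emptyset$ there is $U\in\mathcal{U}$ with $V\cup V'\subset U$. Stars: $\mathrm{St}[Y,\mathcal{U}]=\bigcup\{U\in\mathcal{U}: Y\cap U\neq\emptyset\}$, $\mathrm{St}[x,\mathcal{U}]=\mathrm{St}[\{x\},\mathcal{U}]$. A family $\mathcal{O}$ of open coverings of $X$ is admissible if (1) for any $\mathcal{U},\mathcal{V}\in\mathcal{O}$ there is $\mathcal{W}\in\mathcal{O}$ with $\mathcal{W}\leqslant\frac12\mathcal{U}$ and $\mathcal{W}\leqslant\frac12\mathcal{V}$; and (2) the stars $\mathrm{St}[x,\mathcal{U}]$, $x\in X$, $\mathcal{U}\in\mathcal{O}$, form a basis for the topology of $X$. Define $\rho(x,y)=\{\mathcal{U}\in\mathcal{O}: y\in\mathrm{St}[x,\mathcal{U}]\}$. A nonempty $Y\subset X$ is bounded if there is $\mathcal{U}\in\mathcal{O}$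 with $\mathcal{U}\in\rho(x,y)$ for all $x,y\in Y$. For nonempty $Y\subset X$, $\mathrm{D}(Y)=\bigcap_{x,y\in Y}\rho(x,y)$ and $\gamma(Y)=\{\mathcal{U}\in\mathcal{O}: Y\text{ admits a finite cover }Y\subset\bigcup_{i=1}^{n}X_{i}\text{ with }\mathcal{U}\in\mathrm{D}(X_{i})\text{ for each }i\}$. A net $(x_{\lambda})$ is $\mathcal{O}$-Cauchy if for each $\mathcal{U}\in\mathcal{O}$ there is $\lambda_{0}$ with $\mathcal{U}\in\rho(x_{\lambda_{1}},x_{\lambda_{2}})$ whenever $\lambda_{1},\lambda_{2}\geq\lambda_{0}$; $X$ is a complete admissible space if every $\mathcal{O}$-Cauchy net converges. $\mathcal{H}(X)$ is the set of nonempty closed subsets of $X$ with the uniform topology of the diagonal uniformity with base the sets $D_{\mathcal{U}}=\bigcup\{\mathrm{B}_{H}(A,\mathcal{U})\times\mathrm{B}_{H}(A,\mathcal{U}):A\in\mathcal{H}(X)\}$, $\mathcal{U}\in\mathcal{O}$, where $\mathrm{B}_{H}(A,\mathcal{U})=\{B\in\mathcal{H}(X): A\subset\mathrm{St}[B,\mathcal{U}],\ B\subset\mathrm{St}[A,\mathcal{U}]\}$. An action of $S$ on $X$ is a continuous map $S\times X\to X$, $(s,x)\mapsto sx$, with $s(tx)=(st)x$. For $A\subset S$, $Y\subset X$, $AY=\{sy:s\in A,y\in Y\}$. A filter basis on the subsets of $S$ is a (nonempty) family $\mathcal{F}$ of subsets of $S$ with $\emptyset\notin\mathcal{F}$ such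 that for $A,B\in\mathcal{F}$ there is $C\in\mathcal{F}$ with $C\subset A\cap B$; it is directed by set inclusion (smaller sets come later: $A\geq B$ iff $A\subset B$). $\omega(Y,\mathcal{F})=\bigcap_{A\in\mathcal{F}}\mathrm{cls}(AY)$. The action is $\mathcal{F}$-limit compact if for every bounded $Y\subset X$ and every $\mathcal{U}\in\mathcal{O}$ there is $A\in\mathcal{F}$ with $\mathcal{U}\in\gamma(AY)$. *)

theory Defs
  imports "HOL-Analysis.Analysis"
begin

section \<open>Admissible families of open coverings\<close>

text \<open>The space \<open>X\<close> is the type \<open>'x\<close>. A covering is a set of subsets of \<open>'x\<close>.\<close>

definition open_covering :: "'x::topological_space set set \<Rightarrow> bool" where
  "open_covering \<U> \<longleftrightarrow> (\<forall>U\<in>\<U>. open U) \<and> \<Union>\<U> = UNIV"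

definition half_refines :: "'x set set \<Rightarrow> 'x set set \<Rightarrow> bool" where
  "half_refines \<V> \<U> \<longleftrightarrow>
     (\<forall>V\<in>\<V>. \<forall>V'\<in>\<V>. V \<inter> V' \<noteq> {} \<longrightarrow> (\<exists>U\<in>\<U>. V \<union> V' \<subseteq> U))"

definition St :: "'x set \<Rightarrow> 'x set set \<Rightarrow> 'x set" where
  "St Y \<U> = \<Union>{U\<in>\<U>. Y \<inter> U \<noteq> {}}"

definition admissible_family :: "'x::topological_space set set set \<Rightarrow> bool" where
  "admissible_family \<O> \<longleftrightarrow>
     (\<forall>\<U>\<in>\<O>. open_covering \<U>) \<and>
     (\<forall>\<U>\<in>\<O>. \<forall>\<V>\<in>\<O>. \<exists>\<W>\<in>\<O>. half_refines \<W> \<U> \<and> half_refines \<W> \<V>) \<and>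
     topological_basis {St {x} \<U> |x \<U>. \<U> \<in> \<O>}"

definition rho :: "'x set set set \<Rightarrow> 'x \<Rightarrow> 'x \<Rightarrow> 'x set set set" where
  "rho \<O> x y = {\<U>\<in>\<O>. y \<in> St {x} \<U>}"

definition O_bounded :: "'x set set set \<Rightarrow> 'x set \<Rightarrow> bool" where
  "O_bounded \<O> Y \<longleftrightarrow> Y \<noteq> {} \<and> (\<exists>\<U>\<in>\<O>. \<forall>x\<in>Y. \<forall>y\<in>Y. \<U> \<in> rho \<O> x y)"

definition O_diam :: "'x set set set \<Rightarrow> 'x set \<Rightarrow> 'x set set set" where
  "O_diam \<O> Y = (\<Inter>x\<in>Y. \<Inter>y\<in>Y. rho \<O> x y)"

definition O_gamma :: "'x set set set \<Rightarrow> 'x set \<Rightarrow> 'x set set set" where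
  "O_gamma \<O> Y =
     {\<U>\<in>\<O>. \<exists>\<C>. finite \<C> \<and> Y \<subseteq> \<Union>\<C> \<and> (\<forall>Z\<in>\<C>. Z \<noteq> {} \<and> \<U> \<in> O_diam \<O> Z)}"


section \<open>Nets and completeness\<close>

definition directed_set :: "'i set \<Rightarrow> ('i \<Rightarrow> 'i \<Rightarrow> bool) \<Rightarrow> bool" where
  "directed_set I le \<longleftrightarrow> I \<noteq> {} \<and> reflp_on I le \<and> transp_on I le \<and>
     (\<forall>i\<in>I. \<forall>j\<in>I. \<exists>k\<in>I. le i k \<and> le j k)"

text \<open>The filter of eventual properties of nets indexed by \<open>(I, le)\<close>, where
  \<open>le i j\<close> means that \<open>j\<close> comes after \<open>i\<close>.\<close>

definition net_filter :: "'i set \<Rightarrow> ('i \<Rightarrow> 'i \<Rightarrow> bool) \<Rightarrow> 'i filter" where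
  "net_filter I le = (INF i\<in>I. principal {j\<in>I. le i j})"

lemma eventually_net_filter:
  assumes "directed_set I le"
  shows "eventually P (net_filter I le) \<longleftrightarrow> (\<exists>i\<in>I. \<forall>j\<in>I. le i j \<longrightarrow> P j)"
proof -
  have "\<exists>k\<in>I. principal {l\<in>I. le k l} \<le> inf (principal {l\<in>I. le i l}) (principal {l\<in>I. le j l})"
    if ij: "i \<in> I" "j \<in> I" for i j
  proof -
    obtain k where k: "k \<in> I" "le i k" "le j k"
      using assms ij unfolding directed_set_def by blast
    have "{l\<in>I. le k l} \<subseteq> {l\<in>I. le i l} \<inter> {l\<in>I. le j l}"
      using assms k ij unfolding directed_set_def transp_on_def by blast
    then show ?thesis using k(1) by (metis inf_principal principal_le_iff)
  qed
  moreover have "I \<noteq> {}" using assms by (simp add: directed_set_def)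
  ultimately have "eventually P (net_filter I le) \<longleftrightarrow>
      (\<exists>i\<in>I. eventually P (principal {j\<in>I. le i j}))"
    unfolding net_filter_def by (subst eventually_INF_base) auto
  then show ?thesis by (auto simp: eventually_principal)
qed

definition O_Cauchy ::
  "'x set set set \<Rightarrow> 'i set \<Rightarrow> ('i \<Rightarrow> 'i \<Rightarrow> bool) \<Rightarrow> ('i \<Rightarrow> 'x) \<Rightarrow> bool" where
  "O_Cauchy \<O> I le x \<longleftrightarrow>
     (\<forall>\<U>\<in>\<O>. \<exists>i\<^sub>0\<in>I. \<forall>i\<in>I. \<forall>j\<in>I. le i\<^sub>0 i \<longrightarrow> le i\<^sub>0 j \<longrightarrow> \<U> \<in> rho \<O> (x i) (x j))"

text \<open>A definition cannot quantify over all index types, so the nets here are those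
  indexed by directed sets in \<open>'x \<times> 'x set\<close>. Nothing is lost: by \<open>complete_admissibleD\<close>
  below, Cauchy nets over index sets of any type then converge as well.\<close>

definition complete_admissible :: "'x::topological_space set set set \<Rightarrow> bool" where
  "complete_admissible \<O> \<longleftrightarrow>
     (\<forall>(I :: ('x \<times> 'x set) set) le x.
        directed_set I le \<longrightarrow> O_Cauchy \<O> I le x \<longrightarrow> (\<exists>l. (x \<longlongrightarrow> l) (net_filter I le)))"

lemma complete_admissibleD:
  fixes \<O> :: "'x::topological_space set set set" and x :: "'i \<Rightarrow> 'x"
  assumes "complete_admissible \<O>" and dir: "directed_set I le" and C: "O_Cauchy \<O> I le x"
  shows "\<exists>l. (x \<longlongrightarrow> l) (net_filter I le)"
proof -
  define tail where "tail i = x ` {j\<in>I. le i j}" for i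
  define J where "J = {(y, E). \<exists>i\<in>I. E = tail i \<and> y \<in> E}"
  define le' where "le' = (\<lambda>(p :: 'x \<times> 'x set) (q :: 'x \<times> 'x set). snd q \<subseteq> snd p)"
  have refl: "le i i" if "i \<in> I" for i
    using dir that by (auto simp: directed_set_def reflp_on_def)
  have inJ: "(x j, tail i) \<in> J" if "i \<in> I" "j \<in> I" "le i j" for i j
    using that by (auto simp: J_def tail_def)
  have mono: "tail k \<subseteq> tail i" if "i \<in> I" "k \<in> I" "le i k" for i k
    using that dir unfolding directed_set_def transp_on_def tail_def by blast
  have dirJ: "directed_set J le'"
    unfolding directed_set_def
  proof (intro conjI ballI)
    show "J \<noteq> {}" using dir refl inJ unfolding directed_set_def by blast
    show "reflp_on J le'" by (simp add: reflp_on_def le'_def)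
    show "transp_on J le'" by (auto simp: transp_on_def le'_def)
    fix p q assume "p \<in> J" "q \<in> J"
    then obtain i j where ij: "i \<in> I" "j \<in> I" "snd p = tail i" "snd q = tail j"
      by (auto simp: J_def)
    then obtain k where k: "k \<in> I" "le i k" "le j k"
      using dir unfolding directed_set_def by blast
    then have "(x k, tail k) \<in> J" "tail k \<subseteq> tail i" "tail k \<subseteq> tail j"
      using ij inJ refl mono by auto
    then show "\<exists>r\<in>J. le' p r \<and> le' q r"
      using ij by (intro bexI[of _ "(x k, tail k)"]) (simp_all add: le'_def)
  qed
  have "O_Cauchy \<O> J le' fst"
    unfolding O_Cauchy_def
  proof
    fix \<U> assume "\<U> \<in> \<O>"
    then obtain i0 where i0: "i0 \<in> I"
      "\<And>i j. i \<in> I \<Longrightarrow> j \<in> I \<Longrightarrow> le i0 i \<Longrightarrow> le i0 j \<Longrightarrow> \<U> \<in> rho \<O> (x i) (x j)"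
      using C unfolding O_Cauchy_def by blast
    have "\<U> \<in> rho \<O> (fst p) (fst q)"
      if "p \<in> J" "q \<in> J" "le' (x i0, tail i0) p" "le' (x i0, tail i0) q" for p q
    proof -
      have "fst p \<in> tail i0" "fst q \<in> tail i0" using that by (auto simp: J_def le'_def)
      then show ?thesis using i0(2) by (auto simp: tail_def)
    qed
    then show "\<exists>i\<^sub>0\<in>J. \<forall>i\<in>J. \<forall>j\<in>J. le' i\<^sub>0 i \<longrightarrow> le' i\<^sub>0 j \<longrightarrow> \<U> \<in> rho \<O> (fst i) (fst j)"
      using inJ[OF i0(1) i0(1) refl[OF i0(1)]] by blast
  qed
  then obtain l where l: "(fst \<longlongrightarrow> l) (net_filter J le')"
    using assms(1) dirJ unfolding complete_admissible_def by blast
  have "(x \<longlongrightarrow> l) (net_filter I le)"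
  proof (rule topological_tendstoI)
    fix G assume "open G" "l \<in> G"
    then have "eventually (\<lambda>q. fst q \<in> G) (net_filter J le')"
      by (rule topological_tendstoD[OF l])
    then obtain p where p: "p \<in> J" "\<And>q. q \<in> J \<Longrightarrow> le' p q \<Longrightarrow> fst q \<in> G"
      unfolding eventually_net_filter[OF dirJ] by blast
    then obtain i where i: "i \<in> I" "snd p = tail i" by (auto simp: J_def)
    have "x j \<in> G" if "j \<in> I" "le i j" for j
      using p(2)[OF inJ[OF i(1) that]] i(2) by (simp add: le'_def)
    then show "eventually (\<lambda>j. x j \<in> G) (net_filter I le)"
      using i(1) by (auto simp: eventually_net_filter[OF dir])
  qed
  then show ?thesis ..
qed


section \<open>The hyperspace of nonempty closed sets\<close>

definition hyper :: "'x::topological_space set set" where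
  "hyper = {A. closed A \<and> A \<noteq> {}}"

definition hyper_ball :: "'x::topological_space set \<Rightarrow> 'x set set \<Rightarrow> 'x set set" where
  "hyper_ball A \<U> = {B\<in>hyper. A \<subseteq> St B \<U> \<and> B \<subseteq> St A \<U>}"

definition hyper_entourage :: "'x::topological_space set set \<Rightarrow> ('x set \<times> 'x set) set" where
  "hyper_entourage \<U> = (\<Union>A\<in>hyper. hyper_ball A \<U> \<times> hyper_ball A \<U>)"

definition hyper_uniformity ::
  "'x::topological_space set set set \<Rightarrow> ('x set \<times> 'x set) filter" where
  "hyper_uniformity \<O> = (INF \<U>\<in>\<O>. principal (hyper_entourage \<U>))"

text \<open>The topology of a uniformity, as in the class \<open>open_uniformity\<close> but on the carrier
  \<open>hyper\<close> instead of a whole type.\<close>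

definition hyper_topology :: "'x::topological_space set set set \<Rightarrow> 'x set topology" where
  "hyper_topology \<O> = topology (\<lambda>G. G \<subseteq> hyper \<and>
     (\<forall>A\<in>G. eventually (\<lambda>(A', B). A' = A \<longrightarrow> B \<in> G) (hyper_uniformity \<O>)))"

lemma openin_hyper_topology:
  "openin (hyper_topology \<O>) G \<longleftrightarrow> G \<subseteq> hyper \<and>
     (\<forall>A\<in>G. eventually (\<lambda>(A', B). A' = A \<longrightarrow> B \<in> G) (hyper_uniformity \<O>))"
proof -
  have "istopology (\<lambda>G :: 'a set set. G \<subseteq> hyper \<and>
     (\<forall>A\<in>G. eventually (\<lambda>(A', B). A' = A \<longrightarrow> B \<in> G) (hyper_uniformity \<O>)))"
    unfolding istopology_def
  proof (intro conjI allI impI)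
    fix S T :: "'a set set"
    assume S: "S \<subseteq> hyper \<and> (\<forall>A\<in>S. eventually (\<lambda>(A', B). A' = A \<longrightarrow> B \<in> S) (hyper_uniformity \<O>))"
      and T: "T \<subseteq> hyper \<and> (\<forall>A\<in>T. eventually (\<lambda>(A', B). A' = A \<longrightarrow> B \<in> T) (hyper_uniformity \<O>))"
    show "S \<inter> T \<subseteq> hyper" using S by blast
    show "\<forall>A\<in>S \<inter> T. eventually (\<lambda>(A', B). A' = A \<longrightarrow> B \<in> S \<inter> T) (hyper_uniformity \<O>)"
    proof
      fix A assume "A \<in> S \<inter> T"
      then have "eventually (\<lambda>(A', B). A' = A \<longrightarrow> B \<in> S) (hyper_uniformity \<O>)"
        "eventually (\<lambda>(A', B). A' = A \<longrightarrow> B \<in> T) (hyper_uniformity \<O>)"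
        using S T by auto
      then show "eventually (\<lambda>(A', B). A' = A \<longrightarrow> B \<in> S \<inter> T) (hyper_uniformity \<O>)"
        by eventually_elim auto
    qed
  next
    fix \<K> :: "'a set set set"
    assume K: "\<forall>K\<in>\<K>. K \<subseteq> hyper \<and>
      (\<forall>A\<in>K. eventually (\<lambda>(A', B). A' = A \<longrightarrow> B \<in> K) (hyper_uniformity \<O>))"
    show "\<Union>\<K> \<subseteq> hyper" using K by blast
    show "\<forall>A\<in>\<Union>\<K>. eventually (\<lambda>(A', B). A' = A \<longrightarrow> B \<in> \<Union>\<K>) (hyper_uniformity \<O>)"
    proof
      fix A assume "A \<in> \<Union>\<K>"
      then obtain K0 where K0: "K0 \<in> \<K>" "A \<in> K0" by blast
      then have "eventually (\<lambda>(A', B). A' = A \<longrightarrow> B \<in> K0) (hyper_uniformity \<O>)"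
        using K by blast
      then show "eventually (\<lambda>(A', B). A' = A \<longrightarrow> B \<in> \<Union>\<K>) (hyper_uniformity \<O>)"
        by eventually_elim (use K0 in auto)
    qed
  qed
  then show ?thesis unfolding hyper_topology_def by simp
qed

lemma half_refines_St_mono:
  assumes "half_refines \<W> \<U>"
  shows "St A \<W> \<subseteq> St A \<U>"
proof
  fix x assume "x \<in> St A \<W>"
  then obtain W where W: "W \<in> \<W>" "A \<inter> W \<noteq> {}" "x \<in> W" by (auto simp: St_def)
  then have "W \<inter> W \<noteq> {}" by blast
  then obtain U where "U \<in> \<U>" "W \<union> W \<subseteq> U"
    using assms W(1) unfolding half_refines_def by meson
  then show "x \<in> St A \<U>" using W by (auto simp: St_def)
qed

lemma admissible_family_nonempty:
  assumes "admissible_family (\<O> :: 'x::topological_space set set set)"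
  shows "\<O> \<noteq> {}"
proof
  assume "\<O> = {}"
  then have "topological_basis ({} :: 'x set set)"
    using assms by (simp add: admissible_family_def)
  then have "{} = (UNIV :: 'x set)"
    unfolding topological_basis_def by (auto dest: spec[of _ UNIV])
  then show False by (rule UNIV_not_empty[symmetric, THEN notE])
qed

text \<open>For an admissible family, the sets \<open>hyper_entourage \<U>\<close> are a base of
  \<open>hyper_uniformity \<O>\<close>, and not merely a subbase.\<close>

lemma eventually_hyper_uniformity:
  assumes "admissible_family \<O>"
  shows "eventually P (hyper_uniformity \<O>) \<longleftrightarrow> (\<exists>\<U>\<in>\<O>. \<forall>p\<in>hyper_entourage \<U>. P p)"
proof -
  have "\<exists>\<W>\<in>\<O>. principal (hyper_entourage \<W>) \<le>
          inf (principal (hyper_entourage \<U>)) (principal (hyper_entourage \<V>))"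
    if UV: "\<U> \<in> \<O>" "\<V> \<in> \<O>" for \<U> \<V>
  proof -
    obtain \<W> where W: "\<W> \<in> \<O>" "half_refines \<W> \<U>" "half_refines \<W> \<V>"
      using assms UV unfolding admissible_family_def by meson
    have "hyper_entourage \<W> \<subseteq> hyper_entourage \<X>" if "half_refines \<W> \<X>" for \<X>
    proof -
      have "hyper_ball A \<W> \<subseteq> hyper_ball A \<X>" for A
        using half_refines_St_mono[OF that] unfolding hyper_ball_def by (auto dest: subsetD)
      then show ?thesis unfolding hyper_entourage_def by (meson Sigma_mono UN_mono order_refl)
    qed
    then have "hyper_entourage \<W> \<subseteq> hyper_entourage \<U>" "hyper_entourage \<W> \<subseteq> hyper_entourage \<V>"
      using W by simp_all
    then show ?thesis using W(1) by (intro bexI[of _ \<W>]) simp_all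
  qed
  then have "eventually P (hyper_uniformity \<O>) \<longleftrightarrow>
      (\<exists>\<U>\<in>\<O>. eventually P (principal (hyper_entourage \<U>)))"
    unfolding hyper_uniformity_def
    using admissible_family_nonempty[OF assms] by (subst eventually_INF_base) auto
  then show ?thesis by (simp add: eventually_principal)
qed

lemma topspace_hyper_topology:
  assumes "admissible_family \<O>"
  shows "topspace (hyper_topology \<O>) = hyper"
proof -
  have "openin (hyper_topology \<O>) hyper"
    unfolding openin_hyper_topology eventually_hyper_uniformity[OF assms]
    using admissible_family_nonempty[OF assms]
    by (auto simp: hyper_entourage_def hyper_ball_def)
  then have "hyper \<subseteq> topspace (hyper_topology \<O>)" by (rule openin_subset)
  moreover have "topspace (hyper_topology \<O>) \<subseteq> hyper"
    using openin_topspace[of "hyper_topology \<O>"] unfolding openin_hyper_topology by (rule conjunct1)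
  ultimately show ?thesis by (rule subset_antisym[rotated])
qed


section \<open>Semigroup actions\<close>

definition semigroup_action ::
  "('s::topological_semigroup_mult \<Rightarrow> 'x::topological_space \<Rightarrow> 'x) \<Rightarrow> bool" where
  "semigroup_action act \<longleftrightarrow>
     continuous_on UNIV (\<lambda>(s, x). act s x) \<and> (\<forall>s t x. act s (act t x) = act (s * t) x)"

definition act_set :: "('s \<Rightarrow> 'x \<Rightarrow> 'x) \<Rightarrow> 's set \<Rightarrow> 'x set \<Rightarrow> 'x set" where
  "act_set act A Y = {act s y |s y. s \<in> A \<and> y \<in> Y}"

definition filter_basis :: "'s set set \<Rightarrow> bool" where
  "filter_basis \<F> \<longleftrightarrow> \<F> \<noteq> {} \<and> {} \<notin> \<F> \<and> (\<forall>A\<in>\<F>. \<forall>B\<in>\<F>. \<exists>C\<in>\<F>. C \<subseteq> A \<inter> B)"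

definition omega_limit ::
  "('s \<Rightarrow> 'x::topological_space \<Rightarrow> 'x) \<Rightarrow> 'x set \<Rightarrow> 's set set \<Rightarrow> 'x set" where
  "omega_limit act Y \<F> = (\<Inter>A\<in>\<F>. closure (act_set act A Y))"

definition limit_compact ::
  "'x set set set \<Rightarrow> ('s \<Rightarrow> 'x \<Rightarrow> 'x) \<Rightarrow> 's set set \<Rightarrow> bool" where
  "limit_compact \<O> act \<F> \<longleftrightarrow>
     (\<forall>Y. O_bounded \<O> Y \<longrightarrow> (\<forall>\<U>\<in>\<O>. \<exists>A\<in>\<F>. \<U> \<in> O_gamma \<O> (act_set act A Y)))"

end

theory Submission
  imports Defs
begin

text \<open>
  The argument is the classical one for total boundedness plus completeness, carried out with
  filters. Limit compactness says that, for each covering \<open>\<U>\<close>, some set \<open>AY\<close> is a finite union of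
  \<open>\<U>\<close>-small pieces; after passing to a covering that refines \<open>\<U>\<close> twice, the same holds for
  \<open>closure (AY)\<close> (\<open>star_small_closure\<close>). Hence an ultrafilter that contains all the sets
  \<open>closure (AY)\<close> contains a \<open>\<U>\<close>-small piece for every \<open>\<U>\<close>, so it is Cauchy and converges. Since
  every proper filter is contained in an ultrafilter, every proper filter below the limit filter
  \<open>\<Sqinter>A\<in>\<F>. principal (closure (AY))\<close> has a cluster point, and this cluster point lies in
  \<open>\<omega>(Y, \<F>)\<close> (\<open>limit_filter_cluster_point\<close>).

  The three claims follow from this fact. Applied to an arbitrary filter on \<open>\<omega>(Y, \<F>)\<close>, it is
  compactness. Next, let \<open>G\<close> be an open set around \<open>\<omega>(Y, \<F>)\<close>. The filter generated by the sets
  \<open>closure (AY) - G\<close> cannot have a cluster point in \<open>\<omega>(Y, \<F>) \<subseteq> G\<close>, so it is improper, that is,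
  \<open>closure (AY) \<subseteq> G\<close> for some \<open>A\<close> (\<open>limit_filter_in_open\<close>). With \<open>G = {}\<close> this shows that
  \<open>\<omega>(Y, \<F>)\<close> is nonempty, and with \<open>G = St \<omega> \<U>\<close> it gives one half of Hausdorff closeness; the other
  half is free because \<open>\<omega> \<subseteq> closure (AY)\<close>.
\<close>

section \<open>Ultrafilters and cluster points\<close>

lemma Inf_chain_neq_bot:
  fixes \<C> :: "'a filter set"
  assumes "\<C> \<noteq> {}" and "\<And>F G. F \<in> \<C> \<Longrightarrow> G \<in> \<C> \<Longrightarrow> F \<le> G \<or> G \<le> F"
    and "\<And>F. F \<in> \<C> \<Longrightarrow> F \<noteq> bot"
  shows "Inf \<C> \<noteq> bot"
proof
  assume "Inf \<C> = bot"
  then have "eventually (\<lambda>_. False) (Inf \<C>)" by simp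
  moreover have "\<exists>H\<in>\<C>. H \<le> inf F G" if "F \<in> \<C>" "G \<in> \<C>" for F G
    using assms(2)[OF that] that by (meson le_inf_iff order_refl)
  ultimately obtain F where "F \<in> \<C>" "eventually (\<lambda>_. False) F"
    using assms(1) by (subst (asm) eventually_Inf_base) auto
  then show False using assms(3) by (simp add: trivial_limit_def)
qed

text \<open>In the order of filters, finer means smaller, so an ultrafilter is a minimal proper
  filter.\<close>

lemma ultrafilter_exists:
  fixes F :: "'a filter"
  assumes "F \<noteq> bot"
  obtains E where "E \<le> F" "E \<noteq> bot" "\<And>P. eventually P E \<or> eventually (\<lambda>x. \<not> P x) E"
proof -
  let ?\<A> = "{E. E \<noteq> bot \<and> E \<le> F}"
  have "\<exists>m\<in>?\<A>. \<forall>a\<in>?\<A>. m \<ge> a \<longrightarrow> a = m"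
  proof (rule predicate_Zorn)
    show "partial_order_on ?\<A> (relation_of (\<ge>) ?\<A>)"
      by (rule partial_order_on_relation_ofI) auto
    fix \<C> assume C: "\<C> \<in> Chains (relation_of (\<ge>) ?\<A>)"
    show "\<exists>u\<in>?\<A>. \<forall>a\<in>\<C>. a \<ge> u"
    proof (cases "\<C> = {}")
      case True
      then show ?thesis using assms by auto
    next
      case False
      have sub: "\<C> \<subseteq> ?\<A>"
        using C by (auto simp: Chains_def relation_of_def)
      have "Inf \<C> \<noteq> bot"
      proof (rule Inf_chain_neq_bot[OF False])
        show "G \<le> H \<or> H \<le> G" if "G \<in> \<C>" "H \<in> \<C>" for G H
          using C that by (auto simp: Chains_def relation_of_def)
        show "G \<noteq> bot" if "G \<in> \<C>" for G
          using sub that by blast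
      qed
      moreover have "Inf \<C> \<le> F"
        using False sub by (metis (mono_tags, lifting) Inf_lower2 equals0I mem_Collect_eq subsetD)
      ultimately show ?thesis by (auto intro!: bexI[of _ "Inf \<C>"] Inf_lower)
    qed
  qed
  then obtain E where E: "E \<noteq> bot" "E \<le> F"
    and min: "\<And>G. G \<noteq> bot \<Longrightarrow> G \<le> E \<Longrightarrow> G = E"
    by (auto dest: order_trans)
  have "eventually P E \<or> eventually (\<lambda>x. \<not> P x) E" for P
  proof (cases "inf E (principal {x. P x}) = bot")
    case True
    then have "eventually (\<lambda>_. False) (inf E (principal {x. P x}))" by simp
    then show ?thesis by (simp add: eventually_inf_principal)
  next
    case False
    then have "inf E (principal {x. P x}) = E" by (simp add: min)
    then have "E \<le> principal {x. P x}" by (metis inf_le2)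
    then show ?thesis by (simp add: le_principal)
  qed
  with E that show thesis by blast
qed

lemma ultrafilter_finite_cover:
  assumes ultra: "\<And>P. eventually P E \<or> eventually (\<lambda>x. \<not> P x) E" and "E \<noteq> bot"
    and "finite \<C>" and "eventually (\<lambda>x. x \<in> \<Union>\<C>) E"
  shows "\<exists>Z\<in>\<C>. eventually (\<lambda>x. x \<in> Z) E"
proof (rule ccontr)
  assume "\<not> ?thesis"
  then have "\<forall>Z\<in>\<C>. eventually (\<lambda>x. x \<notin> Z) E" using ultra by blast
  then have "eventually (\<lambda>x. \<forall>Z\<in>\<C>. x \<notin> Z) E"
    using \<open>finite \<C>\<close> by (simp add: eventually_ball_finite)
  with assms(4) have "eventually (\<lambda>_. False) E"
    by eventually_elim blast
  with \<open>E \<noteq> bot\<close> show False by (simp add: trivial_limit_def)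
qed

lemma cluster_point_in_closure:
  assumes "inf (nhds x) F \<noteq> bot" and "F \<le> principal B"
  shows "x \<in> closure B"
proof (rule ccontr)
  assume "x \<notin> closure B"
  then have "eventually (\<lambda>y. y \<in> - closure B) (nhds x)"
    by (intro eventually_nhds_in_open) auto
  moreover have "eventually (\<lambda>y. y \<in> closure B) F"
    using assms(2) closure_subset[of B] by (auto simp: le_principal elim: eventually_mono)
  ultimately have "eventually (\<lambda>_. False) (inf (nhds x) F)"
    unfolding eventually_inf by fastforce
  with assms(1) show False by (simp add: trivial_limit_def)
qed

section \<open>Small sets and total boundedness\<close>

definition star_small :: "'x set set \<Rightarrow> 'x set \<Rightarrow> bool" where
  "star_small \<U> Z \<longleftrightarrow> (\<forall>x\<in>Z. \<forall>y\<in>Z. y \<in> St {x} \<U>)"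

lemma in_St_singleton: "y \<in> St {x} \<U> \<longleftrightarrow> (\<exists>U\<in>\<U>. x \<in> U \<and> y \<in> U)"
  by (auto simp: St_def)

lemma open_St:
  assumes "open_covering \<U>"
  shows "open (St A \<U>)"
  using assms by (auto simp: St_def open_covering_def)

lemma subset_St:
  assumes "open_covering \<U>" and "A \<subseteq> B"
  shows "A \<subseteq> St B \<U>"
proof
  fix x assume "x \<in> A"
  moreover have "x \<in> \<Union>\<U>" using assms(1) by (simp add: open_covering_def)
  ultimately show "x \<in> St B \<U>" using assms(2) by (auto simp: St_def)
qed

lemma half_refines_join:
  assumes "half_refines \<V> \<U>" and "V \<in> \<V>" "V' \<in> \<V>" "z \<in> V" "z \<in> V'"
  obtains U where "U \<in> \<U>" "V \<subseteq> U" "V' \<subseteq> U"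
proof -
  have "V \<inter> V' \<noteq> {}" using assms(4,5) by blast
  then obtain U where "U \<in> \<U>" "V \<union> V' \<subseteq> U"
    using assms(1-3) unfolding half_refines_def by meson
  with that show thesis by simp
qed

text \<open>Points \<open>x, y\<close> of the closure are linked by a chain of three members of \<open>\<W>\<close>: each lies in
  a common member with a point of \<open>Z\<close>, and these two points lie in a third one. The two
  refinements turn this chain into a single member of \<open>\<U>\<close>.\<close>

lemma star_small_closure:
  assumes cov: "open_covering \<W>" and WV: "half_refines \<W> \<V>" and VU: "half_refines \<V> \<U>"
    and small: "star_small \<W> Z"
  shows "star_small \<U> (closure Z)"
  unfolding star_small_def
proof (intro ballI)
  have near: "\<exists>z\<in>Z. \<exists>W\<in>\<W>. x \<in> W \<and> z \<in> W" if x: "x \<in> closure Z" for x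
  proof -
    have "x \<in> \<Union>\<W>" "\<forall>W\<in>\<W>. open W" using cov by (simp_all add: open_covering_def)
    then obtain W where "W \<in> \<W>" "x \<in> W" "open W" by blast
    moreover have "W \<inter> Z \<noteq> {}"
      using x \<open>x \<in> W\<close> \<open>open W\<close> open_Int_closure_eq_empty by fastforce
    ultimately show ?thesis by blast
  qed
  fix x y assume "x \<in> closure Z" "y \<in> closure Z"
  then obtain x' y' W1 W2 where x': "x' \<in> Z" "W1 \<in> \<W>" "x \<in> W1" "x' \<in> W1"
    and y': "y' \<in> Z" "W2 \<in> \<W>" "y \<in> W2" "y' \<in> W2"
    using near by meson
  obtain W where W: "W \<in> \<W>" "x' \<in> W" "y' \<in> W"
    using small x' y' unfolding star_small_def in_St_singleton by blast
  obtain V1 where V1: "V1 \<in> \<V>" "W1 \<subseteq> V1" "W \<subseteq> V1"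
    using half_refines_join[OF WV x'(2) W(1) x'(4) W(2)] .
  obtain V2 where V2: "V2 \<in> \<V>" "W2 \<subseteq> V2" "W \<subseteq> V2"
    using half_refines_join[OF WV y'(2) W(1) y'(4) W(3)] .
  obtain U where "U \<in> \<U>" "V1 \<subseteq> U" "V2 \<subseteq> U"
    using half_refines_join[OF VU V1(1) V2(1) subsetD[OF V1(3) W(2)] subsetD[OF V2(3) W(2)]] .
  moreover have "x \<in> V1" "y \<in> V2" using V1(2) V2(2) x'(3) y'(3) by auto
  ultimately show "y \<in> St {x} \<U>" by (auto simp: in_St_singleton)
qed

text \<open>The pieces of a finite cover of \<open>M A\<close> are replaced by their closures, which stay small for
  \<open>\<U>\<close> when the pieces are small for a covering that refines \<open>\<U>\<close> twice.\<close>

lemma closure_small_cover: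
  assumes adm: "admissible_family \<O>" and "\<U> \<in> \<O>"
    and tb: "\<forall>\<W>\<in>\<O>. \<exists>A\<in>\<F>. \<W> \<in> O_gamma \<O> (M A)"
  shows "\<exists>A\<in>\<F>. \<exists>\<C>. finite \<C> \<and> closure (M A) \<subseteq> \<Union>\<C> \<and> (\<forall>Z\<in>\<C>. star_small \<U> Z)"
proof -
  obtain \<V> where V: "\<V> \<in> \<O>" "half_refines \<V> \<U>"
    using adm \<open>\<U> \<in> \<O>\<close> unfolding admissible_family_def by meson
  obtain \<W> where W: "\<W> \<in> \<O>" "half_refines \<W> \<V>"
    using adm V(1) unfolding admissible_family_def by meson
  have cov: "open_covering \<W>" using adm W(1) by (simp add: admissible_family_def)
  obtain A where A: "A \<in> \<F>" "\<W> \<in> O_gamma \<O> (M A)" using tb W(1) by blast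
  then obtain \<C> where C: "finite \<C>" "M A \<subseteq> \<Union>\<C>" "\<forall>Z\<in>\<C>. \<W> \<in> O_diam \<O> Z"
    unfolding O_gamma_def by blast
  have "closure (M A) \<subseteq> \<Union>(closure ` \<C>)"
  proof (rule closure_minimal)
    show "M A \<subseteq> \<Union>(closure ` \<C>)"
      using C(2) closure_subset by (meson SUP_upper2 Sup_least order_trans)
    show "closed (\<Union>(closure ` \<C>))"
      using C(1) by (intro closed_UN) simp_all
  qed
  moreover have "star_small \<U> (closure Z)" if "Z \<in> \<C>" for Z
  proof (rule star_small_closure[OF cov W(2) V(2)])
    show "star_small \<W> Z"
      using C(3) that by (auto simp: O_diam_def rho_def star_small_def)
  qed
  ultimately have "finite (closure ` \<C>) \<and> closure (M A) \<subseteq> \<Union>(closure ` \<C>) \<and>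
      (\<forall>Z\<in>closure ` \<C>. star_small \<U> Z)"
    using C(1) by simp
  then show ?thesis
    by - (rule bexI[of _ A, OF _ A(1)], rule exI[of _ "closure ` \<C>"])
qed

section \<open>Convergence of Cauchy filters\<close>

text \<open>A filter is turned into a net by indexing over pairs of a member of the filter and a point
  in it, ordered by reverse inclusion of the members.\<close>

lemma Cauchy_filter_converges:
  fixes E :: "'x::topological_space filter"
  assumes compl: "complete_admissible \<O>" and "E \<noteq> bot"
    and Cauchy: "\<And>\<U>. \<U> \<in> \<O> \<Longrightarrow> \<exists>Z. star_small \<U> Z \<and> eventually (\<lambda>x. x \<in> Z) E"
  shows "\<exists>l. E \<le> nhds l"
proof -
  define J where "J = {(x, Z). x \<in> Z \<and> eventually (\<lambda>x. x \<in> Z) E}"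
  define le where "le = (\<lambda>(p :: 'x \<times> 'x set) (q :: 'x \<times> 'x set). snd q \<subseteq> snd p)"
  have inJ: "\<exists>x. (x, Z) \<in> J" if "eventually (\<lambda>x. x \<in> Z) E" for Z
    using eventually_happens'[OF \<open>E \<noteq> bot\<close> that] that by (auto simp: J_def)
  have dir: "directed_set J le"
    unfolding directed_set_def
  proof (intro conjI ballI)
    show "J \<noteq> {}" using inJ[of UNIV] by auto
    show "reflp_on J le" by (simp add: reflp_on_def le_def)
    show "transp_on J le" by (auto simp: transp_on_def le_def)
    fix p q assume "p \<in> J" "q \<in> J"
    then have "eventually (\<lambda>x. x \<in> snd p \<inter> snd q) E"
      by (auto simp: J_def eventually_conj)
    then obtain x where "(x, snd p \<inter> snd q) \<in> J" using inJ by blast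
    then show "\<exists>r\<in>J. le p r \<and> le q r" by (rule bexI[rotated]) (simp add: le_def)
  qed
  have "O_Cauchy \<O> J le fst"
    unfolding O_Cauchy_def
  proof
    fix \<U> assume U: "\<U> \<in> \<O>"
    then obtain Z x where Z: "star_small \<U> Z" "(x, Z) \<in> J" using Cauchy inJ by blast
    have "\<U> \<in> rho \<O> (fst p) (fst q)"
      if "p \<in> J" "q \<in> J" "le (x, Z) p" "le (x, Z) q" for p q
    proof -
      have "fst p \<in> Z" "fst q \<in> Z" using that by (auto simp: J_def le_def)
      with Z(1) U show ?thesis by (simp add: rho_def star_small_def)
    qed
    with Z(2) show "\<exists>i\<^sub>0\<in>J. \<forall>i\<in>J. \<forall>j\<in>J. le i\<^sub>0 i \<longrightarrow> le i\<^sub>0 j \<longrightarrow> \<U> \<in> rho \<O> (fst i) (fst j)"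
      by blast
  qed
  then obtain l where l: "(fst \<longlongrightarrow> l) (net_filter J le)"
    using complete_admissibleD[OF compl dir] by blast
  have "eventually (\<lambda>x. x \<in> G) E" if G: "open G" "l \<in> G" for G
  proof -
    obtain p where p: "p \<in> J" "\<And>q. q \<in> J \<Longrightarrow> le p q \<Longrightarrow> fst q \<in> G"
      using topological_tendstoD[OF l G] unfolding eventually_net_filter[OF dir] by blast
    \<comment> \<open>Every point of the member \<open>snd p\<close> is the value of the net at some index beyond \<open>p\<close>.\<close>
    have "x \<in> G" if "x \<in> snd p" for x
      using p(2)[of "(x, snd p)"] p(1) that by (auto simp: J_def le_def)
    with p(1) show ?thesis by (auto simp: J_def elim: eventually_mono)
  qed
  then have "E \<le> nhds l"
    by (simp add: le_nhds)
  then show ?thesis ..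
qed

section \<open>The limit filter of a family of sets\<close>

text \<open>The sets \<open>M A\<close> generalize the sets \<open>AY\<close>. An ultrafilter finer than \<open>F\<close> contains every
  \<open>closure (M A)\<close>, hence one of the finitely many small pieces that cover it, so it converges; its
  limit is a cluster point of \<open>F\<close>, and of each \<open>closure (M A)\<close>.\<close>

lemma limit_filter_cluster_point:
  fixes M :: "'s set \<Rightarrow> 'x::topological_space set"
  assumes adm: "admissible_family \<O>" and compl: "complete_admissible \<O>"
    and tb: "\<forall>\<U>\<in>\<O>. \<exists>A\<in>\<F>. \<U> \<in> O_gamma \<O> (M A)"
    and "F \<noteq> bot" and F: "F \<le> (INF A\<in>\<F>. principal (closure (M A)))"
  shows "\<exists>x \<in> (\<Inter>A\<in>\<F>. closure (M A)). inf (nhds x) F \<noteq> bot"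
proof -
  obtain E where E: "E \<le> F" "E \<noteq> bot"
    and ultra: "\<And>P. eventually P E \<or> eventually (\<lambda>x. \<not> P x) E"
    using ultrafilter_exists[OF \<open>F \<noteq> bot\<close>] by blast
  have FM: "F \<le> principal (closure (M A))" if "A \<in> \<F>" for A
    using F that by (rule order_trans[OF _ INF_lower])
  have "\<exists>Z. star_small \<U> Z \<and> eventually (\<lambda>x. x \<in> Z) E" if U: "\<U> \<in> \<O>" for \<U>
  proof -
    obtain A \<C> where A: "A \<in> \<F>" and C: "finite \<C>" "closure (M A) \<subseteq> \<Union>\<C>"
      "\<forall>Z\<in>\<C>. star_small \<U> Z"
      using closure_small_cover[OF adm U tb] by metis
    have "E \<le> principal (\<Union>\<C>)"
      using E(1) FM[OF A] C(2) by (meson order_trans principal_le_iff)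
    then have "eventually (\<lambda>x. x \<in> \<Union>\<C>) E" by (simp add: le_principal)
    then show ?thesis
      using ultrafilter_finite_cover[OF ultra E(2) C(1)] C(3) by blast
  qed
  then obtain x where x: "E \<le> nhds x"
    using Cauchy_filter_converges[OF compl E(2)] by blast
  then have "E \<le> inf (nhds x) F" using E(1) by simp
  then have cl: "inf (nhds x) F \<noteq> bot" using E(2) by (metis bot_unique)
  have "x \<in> closure (M A)" if "A \<in> \<F>" for A
    using cluster_point_in_closure[OF cl FM[OF that]] by simp
  with cl show ?thesis by blast
qed

lemma eventually_limit_filter:
  assumes "\<F> \<noteq> {}" and "\<forall>A\<in>\<F>. \<forall>B\<in>\<F>. \<exists>C\<in>\<F>. M C \<subseteq> M A \<inter> M B"
  shows "eventually P (INF A\<in>\<F>. principal (closure (M A))) \<longleftrightarrow>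
    (\<exists>A\<in>\<F>. \<forall>x\<in>closure (M A). P x)"
proof -
  have "\<exists>C\<in>\<F>. principal (closure (M C)) \<le>
      inf (principal (closure (M A))) (principal (closure (M B)))"
    if AB: "A \<in> \<F>" "B \<in> \<F>" for A B
  proof -
    obtain C where "C \<in> \<F>" "M C \<subseteq> M A" "M C \<subseteq> M B" using bspec[OF bspec[OF assms(2) AB(1)] AB(2)] by auto
    then show ?thesis by (intro bexI[of _ C]) (simp_all add: closure_mono)
  qed
  then show ?thesis
    using assms(1) by (subst eventually_INF_base) (auto simp: eventually_principal)
qed

text \<open>Any open set around the intersection contains some \<open>closure (M A)\<close>: otherwise the traces of
  the limit filter on its complement would have a cluster point in the intersection.\<close>

lemma limit_filter_in_open:
  fixes M :: "'s set \<Rightarrow> 'x::topological_space set"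
  assumes adm: "admissible_family \<O>" and compl: "complete_admissible \<O>"
    and tb: "\<forall>\<U>\<in>\<O>. \<exists>A\<in>\<F>. \<U> \<in> O_gamma \<O> (M A)"
    and ne: "\<F> \<noteq> {}" and dir: "\<forall>A\<in>\<F>. \<forall>B\<in>\<F>. \<exists>C\<in>\<F>. M C \<subseteq> M A \<inter> M B"
    and "open G" and sub: "(\<Inter>A\<in>\<F>. closure (M A)) \<subseteq> G"
  shows "\<exists>A\<in>\<F>. closure (M A) \<subseteq> G"
proof -
  let ?L = "INF A\<in>\<F>. principal (closure (M A))"
  have "inf ?L (principal (- G)) = bot"
  proof (rule ccontr)
    assume "inf ?L (principal (- G)) \<noteq> bot"
    then obtain x where x: "x \<in> (\<Inter>A\<in>\<F>. closure (M A))"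
      "inf (nhds x) (inf ?L (principal (- G))) \<noteq> bot"
      using limit_filter_cluster_point[OF adm compl tb _ inf_le1] by metis
    have "x \<in> closure (- G)"
      using cluster_point_in_closure[OF x(2) inf_le2] .
    with x(1) sub \<open>open G\<close> show False by (auto simp: closure_closed closed_Compl)
  qed
  then have "eventually (\<lambda>_. False) (inf ?L (principal (- G)))" by simp
  then have "eventually (\<lambda>x. x \<in> G) ?L" by (simp add: eventually_inf_principal)
  then show ?thesis unfolding eventually_limit_filter[OF ne dir] by auto
qed

lemma limit_set_nonempty:
  fixes M :: "'s set \<Rightarrow> 'x::topological_space set"
  assumes adm: "admissible_family \<O>" and compl: "complete_admissible \<O>"
    and tb: "\<forall>\<U>\<in>\<O>. \<exists>A\<in>\<F>. \<U> \<in> O_gamma \<O> (M A)"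
    and ne: "\<F> \<noteq> {}" and dir: "\<forall>A\<in>\<F>. \<forall>B\<in>\<F>. \<exists>C\<in>\<F>. M C \<subseteq> M A \<inter> M B"
    and Mne: "\<forall>A\<in>\<F>. M A \<noteq> {}"
  shows "(\<Inter>A\<in>\<F>. closure (M A)) \<noteq> {}"
  \<comment> \<open>If the intersection were empty, then it would lie in the open set \<open>{}\<close>.\<close>
  using limit_filter_in_open[OF adm compl tb ne dir, of "{}"] Mne by auto

lemma limit_set_compact:
  fixes M :: "'s set \<Rightarrow> 'x::topological_space set"
  assumes adm: "admissible_family \<O>" and compl: "complete_admissible \<O>"
    and tb: "\<forall>\<U>\<in>\<O>. \<exists>A\<in>\<F>. \<U> \<in> O_gamma \<O> (M A)"
  shows "compact (\<Inter>A\<in>\<F>. closure (M A))" (is "compact ?\<omega>")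
  unfolding compact_filter
proof (intro allI impI)
  fix F assume "F \<noteq> bot" and "eventually (\<lambda>x. x \<in> ?\<omega>) F"
  then have "F \<le> principal (closure (M A))" if "A \<in> \<F>" for A
    using that by (auto simp: le_principal elim: eventually_mono)
  then have "F \<le> (INF A\<in>\<F>. principal (closure (M A)))" by (intro INF_greatest)
  then show "\<exists>x\<in>?\<omega>. inf (nhds x) F \<noteq> bot"
    by (rule limit_filter_cluster_point[OF adm compl tb \<open>F \<noteq> bot\<close>])
qed

section \<open>Convergence in the hyperspace\<close>

text \<open>The entourage \<open>hyper_entourage \<U>\<close> relates any two members of one ball. Taking the ball around
  \<open>L\<close>, which contains \<open>L\<close>, shows that its section at \<open>L\<close> contains this ball.\<close>

lemma limitin_hyper_topologyI:
  assumes adm: "admissible_family \<O>" and L: "L \<in> hyper"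
    and near: "\<And>\<U>. \<U> \<in> \<O> \<Longrightarrow> eventually (\<lambda>i. f i \<in> hyper_ball L \<U>) N"
  shows "limitin (hyper_topology \<O>) f L N"
  unfolding limitin_def topspace_hyper_topology[OF adm]
proof (intro conjI allI impI L)
  fix G assume "openin (hyper_topology \<O>) G \<and> L \<in> G"
  then have "eventually (\<lambda>(A', B). A' = L \<longrightarrow> B \<in> G) (hyper_uniformity \<O>)"
    unfolding openin_hyper_topology by blast
  then obtain \<U> where U: "\<U> \<in> \<O>" "\<And>B. (L, B) \<in> hyper_entourage \<U> \<Longrightarrow> B \<in> G"
    unfolding eventually_hyper_uniformity[OF adm] by auto
  have "L \<subseteq> St L \<U>"
    using adm U(1) by (intro subset_St) (auto simp: admissible_family_def)
  then have "L \<in> hyper_ball L \<U>" using L by (simp add: hyper_ball_def)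
  then have "B \<in> G" if "B \<in> hyper_ball L \<U>" for B
    using that L U(2) by (auto simp: hyper_entourage_def)
  with near[OF U(1)] show "eventually (\<lambda>i. f i \<in> G) N"
    by (auto elim: eventually_mono)
qed

lemma directed_set_filter_basis:
  assumes "filter_basis \<F>"
  shows "directed_set \<F> (\<lambda>A B. B \<subseteq> A)"
  unfolding directed_set_def
proof (intro conjI ballI)
  show "\<F> \<noteq> {}" using assms by (simp add: filter_basis_def)
  show "reflp_on \<F> (\<lambda>A B. B \<subseteq> A)" by (simp add: reflp_on_def)
  show "transp_on \<F> (\<lambda>A B. B \<subseteq> A)" by (auto simp: transp_on_def)
  fix A B assume "A \<in> \<F>" "B \<in> \<F>"
  then have "\<exists>C\<in>\<F>. C \<subseteq> A \<inter> B" using assms by (simp add: filter_basis_def)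
  then show "\<exists>C\<in>\<F>. C \<subseteq> A \<and> C \<subseteq> B" by simp
qed

theorem proposition12:
  fixes act :: "'s::topological_semigroup_mult \<Rightarrow> 'x::topological_space \<Rightarrow> 'x"
    and \<O> :: "'x set set set"
    and \<F> :: "'s set set"
  assumes "completely_regular_space (euclidean :: 'x topology)"
    and "admissible_family \<O>"
    and "semigroup_action act"
    and "filter_basis \<F>"
    and "complete_admissible \<O>"
    and "limit_compact \<O> act \<F>"
  shows "\<forall>Y. O_bounded \<O> Y \<longrightarrow>
           omega_limit act Y \<F> \<noteq> {} \<and> compact (omega_limit act Y \<F>) \<and>
           limitin (hyper_topology \<O>) (\<lambda>A. closure (act_set act A Y)) (omega_limit act Y \<F>)
             (net_filter \<F> (\<lambda>A B. B \<subseteq> A))"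
proof (intro allI impI)
  fix Y assume Y: "O_bounded \<O> Y"
  let ?M = "\<lambda>A. act_set act A Y"
  let ?\<omega> = "\<Inter>A\<in>\<F>. closure (?M A)"
  note adm = assms(2) and compl = assms(5)
  have tb: "\<forall>\<U>\<in>\<O>. \<exists>A\<in>\<F>. \<U> \<in> O_gamma \<O> (?M A)"
    using assms(6) Y by (simp add: limit_compact_def)
  have ne: "\<F> \<noteq> {}" using assms(4) by (simp add: filter_basis_def)
  have mono: "?M A \<subseteq> ?M B" if "A \<subseteq> B" for A B
    using that by (auto simp: act_set_def)
  have dir: "\<forall>A\<in>\<F>. \<forall>B\<in>\<F>. \<exists>C\<in>\<F>. ?M C \<subseteq> ?M A \<inter> ?M B"
  proof (intro ballI)
    fix A B assume "A \<in> \<F>" "B \<in> \<F>"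
    then obtain C where "C \<in> \<F>" "C \<subseteq> A" "C \<subseteq> B"
      using assms(4) unfolding filter_basis_def by (meson le_inf_iff)
    then show "\<exists>C\<in>\<F>. ?M C \<subseteq> ?M A \<inter> ?M B" using mono by (meson le_inf_iff)
  qed
  have Mne: "\<forall>A\<in>\<F>. ?M A \<noteq> {}"
  proof
    fix A assume "A \<in> \<F>"
    then have "A \<noteq> {}" "Y \<noteq> {}" using assms(4) Y by (auto simp: filter_basis_def O_bounded_def)
    then show "?M A \<noteq> {}" by (auto simp: act_set_def)
  qed
  have \<omega>ne: "?\<omega> \<noteq> {}"
    by (rule limit_set_nonempty[OF adm compl tb ne dir Mne])
  have "limitin (hyper_topology \<O>) (\<lambda>A. closure (?M A)) ?\<omega> (net_filter \<F> (\<lambda>A B. B \<subseteq> A))"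
  proof (rule limitin_hyper_topologyI[OF adm])
    show "?\<omega> \<in> hyper" using \<omega>ne unfolding hyper_def by blast
    fix \<U> assume "\<U> \<in> \<O>"
    then have cov: "open_covering \<U>" using adm by (simp add: admissible_family_def)
    obtain A where A: "A \<in> \<F>" "closure (?M A) \<subseteq> St ?\<omega> \<U>"
      using limit_filter_in_open[OF adm compl tb ne dir open_St[OF cov] subset_St[OF cov order_refl]]
      by blast
    have "closure (?M B) \<in> hyper_ball ?\<omega> \<U>" if B: "B \<in> \<F>" "B \<subseteq> A" for B
    proof -
      have "closure (?M B) \<subseteq> St ?\<omega> \<U>"
        using A(2) closure_mono[OF mono[OF B(2)]] by (rule order_trans[rotated])
      moreover have "?\<omega> \<subseteq> St (closure (?M B)) \<U>"
        using B(1) by (intro subset_St[OF cov] INF_lower)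
      ultimately show ?thesis
        using Mne B(1) by (simp add: hyper_ball_def hyper_def)
    qed
    with A(1) show "eventually (\<lambda>B. closure (?M B) \<in> hyper_ball ?\<omega> \<U>)
        (net_filter \<F> (\<lambda>A B. B \<subseteq> A))"
      unfolding eventually_net_filter[OF directed_set_filter_basis[OF assms(4)]] by blast
  qed
  with \<omega>ne limit_set_compact[OF adm compl tb]
  show "omega_limit act Y \<F> \<noteq> {} \<and> compact (omega_limit act Y \<F>) \<and>
      limitin (hyper_topology \<O>) (\<lambda>A. closure (?M A)) (omega_limit act Y \<F>)
        (net_filter \<F> (\<lambda>A B. B \<subseteq> A))"
    unfolding omega_limit_def by blast
qed

end
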